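(* Let $V$ be uniformly distributed in the rectangle $\mathfrak{R}(o)=[-\ell_x/2,\ell_x/2]\times[-\ell_y/2,\ell_y/2]$, with $\ell_x,\ell_y>0$, and let $u=(u_x,u_y)$ be a fixed reference point with $|u_x|<\ell_x/2$ and $|u_y|<\ell_y/2$. Let $\Theta\in[0,2\pi)$ be the azimuth angle of $V$ as seen from $u$, i.e. $V-u=(R\cos\Theta,R\sin\Theta)$ with $R\ge 0$. Then $\Theta$ has the probability density function on $[0,2\pi)$ $$f_\Theta(\theta)=\frac{1}{2\ell_x\ell_y}\Big(\sum_{i=1}^{4}\frac{h_i^2}{\cos^2\theta}\,\mathbf 1_{[\chi^{(<)}_{i,1},\chi^{(<)}_{i,2})}(\theta)+\sum_{i=5}^{8}\frac{h_i^2}{\sin^2\theta}\,\mathbf 1_{[\chi^{(<)}_{i,1},\chi^{(<)}_{i,2})}(\theta)\Big),$$ and the intervals $[\chi^{(<)}_{i,1},\chi^{(<)}_{i,2})$, $i\in\{1,\dots,8\}$, are pairwise disjoint.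
   Context: $\mathbf 1_A$ is the indicator function of a set $A$; a term multiplied by an indicator equal to $0$ is read as $0$. $h_{x^+}=\frac{\ell_x}{2}-u_x$, $h_{x^-}=-\frac{\ell_x}{2}-u_x$, $h_{y^+}=\frac{\ell_y}{2}-u_y$, $h_{y^-}=-\frac{\ell_y}{2}-u_y$, and $(h_1,\dots,h_8)=(h_{x^+},h_{x^+},-h_{x^-},-h_{x^-},h_{y^+},h_{y^+},-h_{y^-},-h_{y^-})$. Let $\gamma_1=\arctan(h_{y^+}/h_{x^+})$, $\gamma_2=\arctan(h_{y^+}/h_{x^-})+\pi$, $\gamma_3=\arctan(h_{y^-}/h_{x^-})+\pi$, $\gamma_4=\arctan(h_{y^-}/h_{x^+})+2\pi$. The pairs $(\chi^{(<)}_{i,1},\chi^{(<)}_{i,2})$ for $i=1,\dots,8$ are: $(0,\gamma_1)$, $(\gamma_4,2\pi)$, $(\pi,\gamma_3)$, $(\gamma_2,\pi)$, $(\gamma_1,\frac{\pi}{2})$, $(\frac{\pi}{2},\gamma_2)$, $(\gamma_3,\frac{3\pi}{2})$, $(\frac{3\pi}{2},\gamma_4)$. *)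

theory Defs
  imports "HOL-Probability.Probability"
begin

definition rectangle :: "real \<Rightarrow> real \<Rightarrow> (real \<times> real) set" where
  "rectangle lx ly = {- lx / 2 .. lx / 2} \<times> {- ly / 2 .. ly / 2}"

text \<open>A suffix \<open>p\<close> or \<open>m\<close> stands for the superscript plus or minus. The offsets to the left and
  lower sides are negative when the reference point is inside the rectangle.\<close>

definition h_xp :: "real \<Rightarrow> real \<Rightarrow> real" where
  "h_xp lx ux = lx / 2 - ux"

definition h_xm :: "real \<Rightarrow> real \<Rightarrow> real" where
  "h_xm lx ux = - lx / 2 - ux"

definition h_yp :: "real \<Rightarrow> real \<Rightarrow> real" where
  "h_yp ly uy = ly / 2 - uy"

definition h_ym :: "real \<Rightarrow> real \<Rightarrow> real" where
  "h_ym ly uy = - ly / 2 - uy"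

text \<open>Families indexed by \<open>{1..8}\<close> are encoded as zero-based lists, hence the shift \<open>i - 1\<close>.
  They are only meaningful for \<open>i\<close> in that range.\<close>

definition h :: "real \<Rightarrow> real \<Rightarrow> real \<Rightarrow> real \<Rightarrow> nat \<Rightarrow> real" where
  "h lx ly ux uy i =
    [h_xp lx ux, h_xp lx ux, - h_xm lx ux, - h_xm lx ux,
     h_yp ly uy, h_yp ly uy, - h_ym ly uy, - h_ym ly uy] ! (i - 1)"

text \<open>The azimuths of the four corners of the rectangle, counterclockwise from the upper right one.\<close>

definition gamma1 :: "real \<Rightarrow> real \<Rightarrow> real \<Rightarrow> real \<Rightarrow> real" where
  "gamma1 lx ly ux uy = arctan (h_yp ly uy / h_xp lx ux)"

definition gamma2 :: "real \<Rightarrow> real \<Rightarrow> real \<Rightarrow> real \<Rightarrow> real" where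
  "gamma2 lx ly ux uy = arctan (h_yp ly uy / h_xm lx ux) + pi"

definition gamma3 :: "real \<Rightarrow> real \<Rightarrow> real \<Rightarrow> real \<Rightarrow> real" where
  "gamma3 lx ly ux uy = arctan (h_ym ly uy / h_xm lx ux) + pi"

definition gamma4 :: "real \<Rightarrow> real \<Rightarrow> real \<Rightarrow> real \<Rightarrow> real" where
  "gamma4 lx ly ux uy = arctan (h_ym ly uy / h_xp lx ux) + 2 * pi"

definition chi :: "real \<Rightarrow> real \<Rightarrow> real \<Rightarrow> real \<Rightarrow> nat \<Rightarrow> real \<times> real" where
  "chi lx ly ux uy i =
    [(0, gamma1 lx ly ux uy),
     (gamma4 lx ly ux uy, 2 * pi),
     (pi, gamma3 lx ly ux uy),
     (gamma2 lx ly ux uy, pi),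
     (gamma1 lx ly ux uy, pi / 2),
     (pi / 2, gamma2 lx ly ux uy),
     (gamma3 lx ly ux uy, 3 * pi / 2),
     (3 * pi / 2, gamma4 lx ly ux uy)] ! (i - 1)"

definition chi_interval :: "real \<Rightarrow> real \<Rightarrow> real \<Rightarrow> real \<Rightarrow> nat \<Rightarrow> real set" where
  "chi_interval lx ly ux uy i = {fst (chi lx ly ux uy i) ..< snd (chi lx ly ux uy i)}"

text \<open>Where \<open>cos \<theta> = 0\<close> or \<open>sin \<theta> = 0\<close>, the quotients are \<open>0\<close> by the convention \<open>x / 0 = 0\<close>;
  the corresponding indicators vanish there for reference points inside the rectangle.\<close>

definition azimuth_density :: "real \<Rightarrow> real \<Rightarrow> real \<Rightarrow> real \<Rightarrow> real \<Rightarrow> real" where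
  "azimuth_density lx ly ux uy \<theta> =
    1 / (2 * lx * ly) *
      ((\<Sum>i = 1..4. (h lx ly ux uy i)\<^sup>2 / (cos \<theta>)\<^sup>2 * indicator (chi_interval lx ly ux uy i) \<theta>)
     + (\<Sum>i = 5..8. (h lx ly ux uy i)\<^sup>2 / (sin \<theta>)\<^sup>2 * indicator (chi_interval lx ly ux uy i) \<theta>))"

end

theory Submission
  imports Defs
begin

text \<open>In polar coordinates around \<open>u\<close> the ray with azimuth \<open>\<theta>\<close> leaves the rectangle at distance
  \<open>h\<^sub>i / \<bar>cos \<theta>\<bar>\<close> or \<open>h\<^sub>i / \<bar>sin \<theta>\<bar>\<close>, depending on the side it hits, which changes exactly at the
  corner angles. Integrating the radial weight \<open>r\<close> over the ray gives half the squared distance.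
  The polar formula itself comes from slicing the half plane \<open>x > 0\<close> vertically: on a slice,
  \<open>y = x tan \<theta>\<close> is a one-dimensional substitution, and after exchanging the integrals
  \<open>x = r cos \<theta>\<close> is linear in \<open>r\<close>. The other half plane follows by point reflection.\<close>

section \<open>Tangent substitution and polar coordinates in the plane\<close>

lemma borel_measurable_tan_real [measurable]: "(tan :: real \<Rightarrow> real) \<in> borel_measurable borel"
  unfolding tan_def by measurable

text \<open>Lebesgue measure is determined by its values on bounded open intervals. Within the
  principal branch, the preimage of \<open>(l, u)\<close> under \<open>tan\<close> is
  \<open>(arctan l, arctan u)\<close>; the density there is the derivative of \<open>tan\<close>, so
  its integral is \<open>u - l\<close>.\<close>

lemma lborel_eq_distr_tan:
  "lborel = distr (density lborel
     (\<lambda>t. indicator {-pi/2<..<pi/2} t * ennreal (1 / (cos t)\<^sup>2))) borel tan" (is "_ = ?D")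
proof (rule lborel_eqI)
  show "sets ?D = sets borel" by simp
  fix l u :: real
  assume "\<And>b. b \<in> Basis \<Longrightarrow> l \<bullet> b \<le> u \<bullet> b"
  then have lu: "l \<le> u" by simp
  have cos_pos: "0 < cos t" if "arctan l \<le> t" "t \<le> arctan u" for t
    using that arctan_lbound[of l] arctan_ubound[of u] by (intro cos_gt_zero_pi) auto
  have "indicator {-pi/2<..<pi/2} t * indicator (box l u) (tan t)
        = (indicator {arctan l<..<arctan u} t :: ennreal)" for t :: real
  proof (cases "-pi/2 < t \<and> t < pi/2")
    case True
    have "l < tan t \<longleftrightarrow> arctan l < t" "tan t < u \<longleftrightarrow> t < arctan u"
      using True arctan_less_iff[of l "tan t"] arctan_less_iff[of "tan t" u]
      by (simp_all add: arctan_tan del: arctan_less_iff)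
    then show ?thesis using True by (simp add: indicator_def box_real)
  next
    case False
    then have "\<not> (arctan l < t \<and> t < arctan u)"
      using arctan_lbound[of l] arctan_ubound[of u] by auto
    then show ?thesis using False by (auto simp: indicator_def)
  qed
  then have ind: "indicator {-pi/2<..<pi/2} t * ennreal (1 / (cos t)\<^sup>2) * indicator (box l u) (tan t)
       = ennreal (1 / (cos t)\<^sup>2) * indicator {arctan l<..<arctan u} t" for t :: real
    by (metis mult.commute mult.left_commute)
  have "emeasure ?D (box l u) = (\<integral>\<^sup>+t. indicator {-pi/2<..<pi/2} t * ennreal (1 / (cos t)\<^sup>2) *
        indicator (tan -` box l u) t \<partial>lborel)"
    by (subst emeasure_distr, simp, simp, subst emeasure_density)
       (auto simp: measurable_sets_borel[OF borel_measurable_tan_real])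
  also have "\<dots> = (\<integral>\<^sup>+t. ennreal (1 / (cos t)\<^sup>2) * indicator {arctan l<..<arctan u} t \<partial>lborel)"
    unfolding ind[symmetric] by (intro nn_integral_cong) (simp add: indicator_def)
  \<comment> \<open>Adding the two endpoints, a null set, prepares for the fundamental theorem of
    calculus on a closed interval.\<close>
  also have "\<dots> = (\<integral>\<^sup>+t. ennreal (1 / (cos t)\<^sup>2) * indicator {arctan l..arctan u} t \<partial>lborel)"
    using AE_lborel_singleton[of "arctan l"] AE_lborel_singleton[of "arctan u"]
    by (intro nn_integral_cong_AE, eventually_elim) (auto simp: indicator_def)
  also have "\<dots> = ennreal (tan (arctan u) - tan (arctan l))"
  proof (rule nn_integral_FTC_Icc)
    show "(tan has_real_derivative 1 / (cos t)\<^sup>2) (at t)"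
      if "t \<in> {arctan l..arctan u}" for t
      using that DERIV_tan[of t] cos_pos[of t] by (simp add: inverse_eq_divide)
  qed (use lu in \<open>auto simp: arctan_le_iff\<close>)
  finally show "emeasure ?D (box l u) = (\<Prod>b\<in>Basis. (u - l) \<bullet> b)"
    by (simp add: tan_arctan)
qed

lemma nn_integral_tan:
  assumes [measurable]: "f \<in> borel_measurable borel"
  shows "(\<integral>\<^sup>+y. f y \<partial>lborel) =
    (\<integral>\<^sup>+t. indicator {-pi/2<..<pi/2} t * ennreal (1 / (cos t)\<^sup>2) * f (tan t) \<partial>lborel)"
  by (subst lborel_eq_distr_tan) (simp add: nn_integral_distr nn_integral_density)

text \<open>The Jacobian \<open>r\<close> is a product of three factors: \<open>x\<close> from
  scaling \<open>y\<close> by \<open>x\<close>, \<open>1 / (cos t)^2\<close> from the tangent, and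
  \<open>cos t\<close> from \<open>x = r * cos t\<close>. Substituting the last equation into the
  first factor leaves exactly \<open>r\<close>.\<close>

lemma nn_integral_polar_right_half:
  fixes f :: "real \<times> real \<Rightarrow> ennreal"
  assumes [measurable]: "f \<in> borel_measurable borel"
  shows "(\<integral>\<^sup>+x. indicator {0<..} x * (\<integral>\<^sup>+y. f (x, y) \<partial>lborel) \<partial>lborel) =
    (\<integral>\<^sup>+t. indicator {-pi/2<..<pi/2} t *
      (\<integral>\<^sup>+r. ennreal r * f (r * cos t, r * sin t) \<partial>lborel) \<partial>lborel)"
proof -
  have [measurable]: "f \<in> borel_measurable (borel \<Otimes>\<^sub>M borel)"
    by (simp add: borel_prod)
  let ?g = "\<lambda>x t. indicator {-pi/2<..<pi/2} t * ennreal (1 / (cos t)\<^sup>2) * (ennreal x * f (x, x * tan t))"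
  have "indicator {0<..} x * (\<integral>\<^sup>+y. f (x, y) \<partial>lborel) = (\<integral>\<^sup>+t. ?g x t \<partial>lborel)" for x :: real
  proof (cases "0 < x")
    case True
    have "(\<integral>\<^sup>+y. f (x, y) \<partial>lborel) = (\<integral>\<^sup>+y. ennreal x * f (x, x * y) \<partial>lborel)"
      using True nn_integral_real_affine[of "\<lambda>y. f (x, y)" x 0] by (simp add: nn_integral_cmult)
    also have "\<dots> = (\<integral>\<^sup>+t. ?g x t \<partial>lborel)"
      by (rule nn_integral_tan) measurable
    finally show ?thesis using True by simp
  \<comment> \<open>For \<open>x\<close> \<le> 0 the indicator kills the left side and the
    truncation \<open>ennreal x = 0\<close> kills the right side.\<close>
  qed (simp add: ennreal_neg)
  then have "(\<integral>\<^sup>+x. indicator {0<..} x * (\<integral>\<^sup>+y. f (x, y) \<partial>lborel) \<partial>lborel) =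
      (\<integral>\<^sup>+x. \<integral>\<^sup>+t. ?g x t \<partial>lborel \<partial>lborel)" by simp
  also have "\<dots> = (\<integral>\<^sup>+t. \<integral>\<^sup>+x. ?g x t \<partial>lborel \<partial>lborel)"
    by (rule lborel_pair.Fubini'[symmetric]) measurable
  also have "\<dots> = (\<integral>\<^sup>+t. indicator {-pi/2<..<pi/2} t *
      (\<integral>\<^sup>+r. ennreal r * f (r * cos t, r * sin t) \<partial>lborel) \<partial>lborel)"
  proof (rule nn_integral_cong)
    fix t :: real
    show "(\<integral>\<^sup>+x. ?g x t \<partial>lborel) = indicator {-pi/2<..<pi/2} t *
      (\<integral>\<^sup>+r. ennreal r * f (r * cos t, r * sin t) \<partial>lborel)"
    proof (cases "t \<in> {-pi/2<..<pi/2}")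
      case True
      then have c: "0 < cos t" by (intro cos_gt_zero_pi) auto
      have "(\<integral>\<^sup>+x. ?g x t \<partial>lborel) = ennreal (cos t) * (\<integral>\<^sup>+r. ?g (cos t * r) t \<partial>lborel)"
        using c nn_integral_real_affine[of "\<lambda>x. ?g x t" "cos t" 0] by simp
      also have "\<dots> = (\<integral>\<^sup>+r. ennreal (cos t) * ?g (cos t * r) t \<partial>lborel)"
        by (rule nn_integral_cmult[symmetric]) measurable
      also have "\<dots> = (\<integral>\<^sup>+r. ennreal r * f (r * cos t, r * sin t) \<partial>lborel)"
      proof (rule nn_integral_cong)
        fix r :: real
        have "ennreal (cos t) * (ennreal (1 / (cos t)\<^sup>2) * ennreal (cos t * r)) = ennreal r"
          using c by (simp add: ennreal_mult'[symmetric] power2_eq_square)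
        moreover have "cos t * r * tan t = r * sin t" "cos t * r = r * cos t"
          using c by (simp_all add: tan_def)
        moreover have "ennreal (cos t) * ?g (cos t * r) t =
            (ennreal (cos t) * (ennreal (1 / (cos t)\<^sup>2) * ennreal (cos t * r))) * f (cos t * r, cos t * r * tan t)"
          using True by (simp add: mult.assoc)
        ultimately show "ennreal (cos t) * ?g (cos t * r) t = ennreal r * f (r * cos t, r * sin t)"
          by (simp only:)
      qed
      finally show ?thesis using True by simp
    qed simp
  qed
  finally show ?thesis .
qed

text \<open>No restriction to \<open>r > 0\<close> is needed: \<open>ennreal r = 0\<close> for \<open>r \<le> 0\<close>.\<close>

theorem nn_integral_polar:
  fixes f :: "real \<times> real \<Rightarrow> ennreal"
  assumes [measurable]: "f \<in> borel_measurable borel"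
  shows "(\<integral>\<^sup>+v. f v \<partial>lborel) =
    (\<integral>\<^sup>+t. indicator {0..<2*pi} t *
      (\<integral>\<^sup>+r. ennreal r * f (r * cos t, r * sin t) \<partial>lborel) \<partial>lborel)"
proof -
  have [measurable]: "f \<in> borel_measurable (borel \<Otimes>\<^sub>M borel)"
    by (simp add: borel_prod)
  define G where "G x = (\<integral>\<^sup>+y. f (x, y) \<partial>lborel)" for x
  define J where "J t = (\<integral>\<^sup>+r. ennreal r * f (r * cos t, r * sin t) \<partial>lborel)" for t
  have [measurable]: "G \<in> borel_measurable borel" "J \<in> borel_measurable borel"
    unfolding G_def J_def by measurable
  have right: "(\<integral>\<^sup>+x. indicator {0<..} x * G x \<partial>lborel) =
      (\<integral>\<^sup>+t. indicator {-pi/2<..<pi/2} t * J t \<partial>lborel)"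
    unfolding G_def J_def by (rule nn_integral_polar_right_half) measurable
  \<comment> \<open>Both coordinates are negated, one integral at a time. In polar form this keeps
    \<open>r\<close> and adds pi to the angle, which turns (-pi/2, pi/2) into (pi/2, 3
    pi/2).\<close>
  have "(\<integral>\<^sup>+x. indicator {..<0} x * G x \<partial>lborel) = (\<integral>\<^sup>+x. indicator {0<..} x * G (- x) \<partial>lborel)"
    by (subst nn_integral_real_affine[of _ "-1" 0]) (auto intro!: nn_integral_cong simp: indicator_def)
  also have "\<dots> = (\<integral>\<^sup>+x. indicator {0<..} x * (\<integral>\<^sup>+y. f (- x, - y) \<partial>lborel) \<partial>lborel)"
    unfolding G_def by (subst nn_integral_real_affine[of _ "-1" 0]) auto
  also have "\<dots> = (\<integral>\<^sup>+t. indicator {-pi/2<..<pi/2} t *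
      (\<integral>\<^sup>+r. ennreal r * f (- (r * cos t), - (r * sin t)) \<partial>lborel) \<partial>lborel)"
    using nn_integral_polar_right_half[of "\<lambda>v. f (- fst v, - snd v)"]
    by (simp add: borel_prod[symmetric])
  also have "\<dots> = (\<integral>\<^sup>+t. indicator {-pi/2<..<pi/2} t * J (pi + t) \<partial>lborel)"
    unfolding J_def by (simp add: add.commute)
  also have "\<dots> = (\<integral>\<^sup>+t. indicator {pi/2<..<3*pi/2} t * J t \<partial>lborel)"
    by (subst (2) nn_integral_real_affine[of _ 1 pi]) (auto intro!: nn_integral_cong simp: indicator_def)
  finally have left: "(\<integral>\<^sup>+x. indicator {..<0} x * G x \<partial>lborel) =
      (\<integral>\<^sup>+t. indicator {pi/2<..<3*pi/2} t * J t \<partial>lborel)" .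
  have per: "J (t + 2 * pi) = J t" for t unfolding J_def by simp
  \<comment> \<open>The fourth quadrant is moved up by one period so that all angles lie in [0, 2
    pi).\<close>
  have wrap: "(\<integral>\<^sup>+t. indicator {-pi/2<..<0} t * J t \<partial>lborel) =
      (\<integral>\<^sup>+t. indicator {3*pi/2<..<2*pi} t * J t \<partial>lborel)"
    by (subst (2) nn_integral_real_affine[of _ 1 "2*pi"])
       (auto intro!: nn_integral_cong simp: indicator_def per add.commute[of "2*pi"])
  have split: "(\<integral>\<^sup>+t. indicator {-pi/2<..<pi/2} t * J t \<partial>lborel) =
      (\<integral>\<^sup>+t. indicator {-pi/2<..<0} t * J t \<partial>lborel) + (\<integral>\<^sup>+t. indicator {0..<pi/2} t * J t \<partial>lborel)"
    by (subst nn_integral_add[symmetric]) (auto intro!: nn_integral_cong simp: indicator_def)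
  have "(\<integral>\<^sup>+v. f v \<partial>lborel) = (\<integral>\<^sup>+x. G x \<partial>lborel)"
    unfolding G_def by (subst lborel_prod[symmetric], subst lborel.nn_integral_fst) auto
  \<comment> \<open>The axis \<open>x = 0\<close> belongs to neither open half plane and is a null
    set; its two directions pi/2 and 3 pi/2 are restored in the same way at the end.\<close>
  also have "\<dots> = (\<integral>\<^sup>+x. indicator {0<..} x * G x + indicator {..<0} x * G x \<partial>lborel)"
    using AE_lborel_singleton[of 0]
    by (intro nn_integral_cong_AE, eventually_elim) (auto simp: indicator_def)
  also have "\<dots> = (\<integral>\<^sup>+x. indicator {0<..} x * G x \<partial>lborel) + (\<integral>\<^sup>+x. indicator {..<0} x * G x \<partial>lborel)"
    by (rule nn_integral_add) measurable
  also have "\<dots> = (\<integral>\<^sup>+t. indicator {3*pi/2<..<2*pi} t * J t + indicator {0..<pi/2} t * J t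
       + indicator {pi/2<..<3*pi/2} t * J t \<partial>lborel)"
    unfolding right left split wrap by (simp add: nn_integral_add)
  also have "\<dots> = (\<integral>\<^sup>+t. indicator {0..<2*pi} t * J t \<partial>lborel)"
    using AE_lborel_singleton[of "pi/2"] AE_lborel_singleton[of "3*pi/2"]
    by (intro nn_integral_cong_AE, eventually_elim) (auto simp: indicator_def)
  finally show ?thesis unfolding J_def .
qed

section \<open>Measurability of the azimuth and integrals along a ray\<close>

text \<open>\<open>Arg2pi\<close> jumps across the positive real axis, but its strict superlevel
  sets are open.\<close>

lemma borel_measurable_Arg2pi [measurable]: "Arg2pi \<in> borel_measurable borel"
  by (simp add: borel_measurable_iff_greater borel_open open_Arg2pi2pi_gt)

lemma borel_measurable_Complex_diff [measurable]:
  "(\<lambda>v. Complex (fst v - x) (snd v - y)) \<in> borel_measurable borel"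
  by (intro borel_measurable_continuous_onI continuous_on_Complex continuous_intros)

lemma nn_integral_ennreal_Icc:
  assumes "0 \<le> \<rho>"
  shows "(\<integral>\<^sup>+r. ennreal r * indicator {0..\<rho>} r \<partial>lborel) = ennreal (\<rho>\<^sup>2 / 2)"
proof -
  have "((\<lambda>r. r\<^sup>2 / 2) has_real_derivative r) (at r)" for r :: real
    by (rule derivative_eq_intros refl | simp)+
  then show ?thesis
    using assms nn_integral_FTC_Icc[of "\<lambda>r. r" 0 \<rho> "\<lambda>r. r\<^sup>2 / 2"] by simp
qed

lemma nn_integral_translate:
  fixes u :: "'a :: euclidean_space"
  assumes [measurable]: "f \<in> borel_measurable borel"
  shows "(\<integral>\<^sup>+v. f v \<partial>lborel) = (\<integral>\<^sup>+v. f (u + v) \<partial>lborel)"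
  by (subst lborel_distr_plus[of u, symmetric]) (simp add: nn_integral_distr)

text \<open>Clearing the denominator \<open>cos t\<close> keeps the criterion valid at
  \<open>t = -(pi/2)\<close>, where both sides are true. That endpoint occurs for the rays at pi/2
  and 3 pi/2, which open the second and fourth quadrants.\<close>

lemma less_arctan_iff:
  assumes "-(pi/2) \<le> t" "t < pi/2"
  shows "t < arctan y \<longleftrightarrow> sin t < y * cos t"
proof (cases "t = -(pi/2)")
  case True
  then show ?thesis using arctan_lbound[of y] by simp
next
  case False
  with assms have t: "-(pi/2) < t" "t < pi/2" by auto
  then have "0 < cos t" by (rule cos_gt_zero_pi)
  then have "sin t < y * cos t \<longleftrightarrow> tan t < y" by (simp add: tan_def field_simps)
  also have "\<dots> \<longleftrightarrow> t < arctan y"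
    using arctan_less_iff[of "tan t" y] t by (simp add: arctan_tan del: arctan_less_iff)
  finally show ?thesis by simp
qed

text \<open>The last assumption says that the ray meets the side at distance \<open>a\<close> no
  later than the one at distance \<open>b\<close>, so the bound by \<open>b\<close> follows from the
  bound by \<open>a\<close> and the ray leaves at \<open>r = a / C\<close>. The product form also
  admits \<open>S = 0\<close>. Negative \<open>r\<close> carry weight zero.\<close>

lemma nn_integral_radius:
  assumes "0 < a" "0 < C" "0 \<le> S" "a * S \<le> b * C"
  shows "(\<integral>\<^sup>+r. ennreal r * indicator {r. r * C \<le> a \<and> r * S \<le> b} r \<partial>lborel) = ennreal (a\<^sup>2 / C\<^sup>2 / 2)"
proof -
  have "r * S \<le> b" if "r * C \<le> a" for r
  proof -
    have "r * S * C \<le> a * S"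
      using mult_right_mono[OF that \<open>0 \<le> S\<close>] by (simp add: mult_ac)
    with assms(4) have "r * S * C \<le> b * C" by linarith
    then show ?thesis using \<open>0 < C\<close> by simp
  qed
  then have "ennreal r * indicator {r. r * C \<le> a \<and> r * S \<le> b} r = ennreal r * indicator {0..a/C} r" for r
    using assms by (cases "0 \<le> r") (auto simp: indicator_def pos_le_divide_eq ennreal_neg)
  then show ?thesis
    using nn_integral_ennreal_Icc[of "a/C"] assms by (simp add: power_divide)
qed

section \<open>Corner angles and the explicit density\<close>

locale rectangle_point =
  fixes lx ly ux uy :: real
  assumes ux: "\<bar>ux\<bar> < lx / 2" and uy: "\<bar>uy\<bar> < ly / 2"
begin

text \<open>The positive distances from the reference point to the right, left, upper and lower
  sides, in this order.\<close>

abbreviation "a\<^sub>1 \<equiv> h_xp lx ux"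
abbreviation "a\<^sub>2 \<equiv> - h_xm lx ux"
abbreviation "b\<^sub>1 \<equiv> h_yp ly uy"
abbreviation "b\<^sub>2 \<equiv> - h_ym ly uy"
abbreviation "\<gamma>\<^sub>1 \<equiv> gamma1 lx ly ux uy"
abbreviation "\<gamma>\<^sub>2 \<equiv> gamma2 lx ly ux uy"
abbreviation "\<gamma>\<^sub>3 \<equiv> gamma3 lx ly ux uy"
abbreviation "\<gamma>\<^sub>4 \<equiv> gamma4 lx ly ux uy"

lemma sides_pos: "0 < lx" "0 < ly"
  using ux uy by auto

lemma h_pos: "0 < a\<^sub>1" "0 < a\<^sub>2" "0 < b\<^sub>1" "0 < b\<^sub>2"
  using ux uy by (auto simp: h_xp_def h_xm_def h_yp_def h_ym_def)

text \<open>The signs of the four quotients fix the signs of the arctangents, whose absolute values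
  stay below pi/2; the added multiples of pi then put each corner into its own open
  quadrant.\<close>

lemma gamma_order:
  "0 < \<gamma>\<^sub>1" "\<gamma>\<^sub>1 < pi/2" "pi/2 < \<gamma>\<^sub>2" "\<gamma>\<^sub>2 < pi" "pi < \<gamma>\<^sub>3" "\<gamma>\<^sub>3 < 3*pi/2" "3*pi/2 < \<gamma>\<^sub>4" "\<gamma>\<^sub>4 < 2*pi"
proof -
  have "0 < b\<^sub>1 / a\<^sub>1" "b\<^sub>1 / h_xm lx ux < 0" "0 < h_ym ly uy / h_xm lx ux" "h_ym ly uy / a\<^sub>1 < 0"
    using h_pos by (auto simp: divide_simps)
  then have "0 < arctan (b\<^sub>1 / a\<^sub>1)" "arctan (b\<^sub>1 / h_xm lx ux) < 0"
     "0 < arctan (h_ym ly uy / h_xm lx ux)" "arctan (h_ym ly uy / a\<^sub>1) < 0"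
    by (auto simp: arctan_less_zero_iff zero_less_arctan_iff)
  moreover have "- (pi/2) < arctan z" "arctan z < pi/2" for z
    by (rule arctan_lbound arctan_ubound)+
  note this[of "b\<^sub>1 / a\<^sub>1"] this[of "b\<^sub>1 / h_xm lx ux"] this[of "h_ym ly uy / h_xm lx ux"] this[of "h_ym ly uy / a\<^sub>1"]
  ultimately
  show "0 < \<gamma>\<^sub>1" "\<gamma>\<^sub>1 < pi/2" "pi/2 < \<gamma>\<^sub>2" "\<gamma>\<^sub>2 < pi" "pi < \<gamma>\<^sub>3" "\<gamma>\<^sub>3 < 3*pi/2" "3*pi/2 < \<gamma>\<^sub>4" "\<gamma>\<^sub>4 < 2*pi"
    unfolding gamma1_def gamma2_def gamma3_def gamma4_def by linarith+
qed

text \<open>Sorted by angle, the eight intervals are the consecutive pieces between the corner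
  angles and the multiples of pi/2; a common endpoint belongs only to the piece on its
  right.\<close>

lemma disjoint_chi_interval: "disjoint_family_on (chi_interval lx ly ux uy) {1..8}"
proof -
  have "{1..8::nat} = {1,2,3,4,5,6,7,8}" by auto
  then show ?thesis
    using gamma_order by (auto simp: disjoint_family_on_def chi_interval_def chi_def)
qed

lemma azimuth_density_expand:
  "azimuth_density lx ly ux uy t = 1 / (2 * lx * ly) *
    (a\<^sub>1\<^sup>2 / (cos t)\<^sup>2 * indicator {0..<\<gamma>\<^sub>1} t + a\<^sub>1\<^sup>2 / (cos t)\<^sup>2 * indicator {\<gamma>\<^sub>4..<2*pi} t
   + a\<^sub>2\<^sup>2 / (cos t)\<^sup>2 * indicator {pi..<\<gamma>\<^sub>3} t + a\<^sub>2\<^sup>2 / (cos t)\<^sup>2 * indicator {\<gamma>\<^sub>2..<pi} t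
   + b\<^sub>1\<^sup>2 / (sin t)\<^sup>2 * indicator {\<gamma>\<^sub>1..<pi/2} t + b\<^sub>1\<^sup>2 / (sin t)\<^sup>2 * indicator {pi/2..<\<gamma>\<^sub>2} t
   + b\<^sub>2\<^sup>2 / (sin t)\<^sup>2 * indicator {\<gamma>\<^sub>3..<3*pi/2} t + b\<^sub>2\<^sup>2 / (sin t)\<^sup>2 * indicator {3*pi/2..<\<gamma>\<^sub>4} t)"
proof -
  have "{1..4::nat} = {1,2,3,4}" "{5..8::nat} = {5,6,7,8}" by auto
  then show ?thesis
    by (simp add: azimuth_density_def h_def chi_interval_def chi_def)
qed

text \<open>This absorbs the indicator of [0, 2 pi) that the polar formula carries.\<close>

lemma azimuth_density_outside: "t \<notin> {0..<2*pi} \<Longrightarrow> azimuth_density lx ly ux uy t = 0"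
proof -
  assume "t \<notin> {0..<2*pi}"
  then have "t < 0 \<or> 2*pi \<le> t" by auto
  then show ?thesis
    using gamma_order pi_gt_zero by (elim disjE) (simp_all add: azimuth_density_expand indicator_def)
qed

lemma borel_measurable_azimuth_density [measurable]:
  "azimuth_density lx ly ux uy \<in> borel_measurable borel"
  unfolding azimuth_density_expand[abs_def] by measurable

section \<open>Radial integrals over the rectangle\<close>

text \<open>One quadrant at a time: \<open>C\<close> and \<open>S\<close> are the absolute values of cosine and sine, and \<open>a\<close> and \<open>b\<close>
  the distances to the two sides that bound the quadrant. Taking these nonnegative quantities in
  either order covers all four quadrants.\<close>

lemma nn_integral_radial_slice_abs:
  assumes q: "\<And>r. 0 \<le> r \<Longrightarrow> (ux + r * c, uy + r * s) \<in> rectangle lx ly \<longleftrightarrow> r * C \<le> a \<and> r * S \<le> b"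
    and ab: "0 < a" "0 < b" and CS: "0 \<le> C" "0 \<le> S" "C \<noteq> 0 \<or> S \<noteq> 0"
  shows "(\<integral>\<^sup>+r. ennreal r * indicator (rectangle lx ly) (ux + r * c, uy + r * s) \<partial>lborel) =
    ennreal ((if a * S < b * C then a\<^sup>2 / C\<^sup>2 else b\<^sup>2 / S\<^sup>2) / 2)"
proof -
  have eq: "ennreal r * indicator (rectangle lx ly) (ux + r * c, uy + r * s) =
      ennreal r * indicator {r. r * C \<le> a \<and> r * S \<le> b} r" for r
    using q[of r] by (cases "0 \<le> r") (auto simp: indicator_def ennreal_neg)
  show ?thesis
  proof (cases "a * S < b * C")
    case True
    \<comment> \<open>The chosen quotient never has denominator zero: \<open>C = 0\<close> would
      give \<open>a * S < 0\<close>, and in the other case \<open>S = 0\<close> would give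
      \<open>b * C\<close> \<le> 0 although \<open>C\<close> is then positive.\<close>
    then have "C \<noteq> 0" using ab CS by (auto simp: mult_less_0_iff)
    then show ?thesis using True nn_integral_radius[of a C S b] ab CS by (simp add: eq)
  next
    case False
    then have "S \<noteq> 0" using ab CS by (auto simp: zero_less_mult_iff)
    then show ?thesis using False nn_integral_radius[of b S C a] ab CS
      by (simp add: eq conj_commute not_less)
  qed
qed

lemma in_rectangle_iff:
  "(ux + x, uy + y) \<in> rectangle lx ly \<longleftrightarrow> - a\<^sub>2 \<le> x \<and> x \<le> a\<^sub>1 \<and> - b\<^sub>2 \<le> y \<and> y \<le> b\<^sub>1"
  by (auto simp: rectangle_def h_xp_def h_xm_def h_yp_def h_ym_def)

text \<open>In each quadrant the comparison of products that selects the side hit is the comparison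
  of \<open>t\<close> with the corner angle. Vertical sides come first in quadrants one and three,
  horizontal ones in two and four, so the roles of the two sides alternate. A ray through a corner
  counts for the later piece, as the half-open intervals require.\<close>

lemma nn_integral_radial_slice:
  assumes t: "t \<in> {0..<2*pi}"
  shows "(\<integral>\<^sup>+r. ennreal r * indicator (rectangle lx ly) (ux + r * cos t, uy + r * sin t) \<partial>lborel) =
    ennreal (lx * ly * azimuth_density lx ly ux uy t)" (is "?L = _")
proof -
  have nz: "cos t \<noteq> 0 \<or> sin t \<noteq> 0"
    using sin_zero_abs_cos_one[of t] by auto
  \<comment> \<open>This settles the constraints from the two sides that the ray does not
    approach.\<close>
  have nonpos: "r * x \<le> z" if "0 \<le> r" "x \<le> 0" "0 < z" for r x z :: real
    using mult_nonneg_nonpos[OF that(1,2)] that(3) by linarith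
  \<comment> \<open>The sign of \<open>x\<close> matters because both left corners have the negative
    denominator \<open>h_xm lx ux\<close>, which reverses the inequality.\<close>
  have arctan_cases: "s < arctan (y / x) \<longleftrightarrow> (if 0 < x then x * sin s < y * cos s else y * cos s < x * sin s)"
    if "x \<noteq> 0" "-(pi/2) \<le> s" "s < pi/2" for s x y :: real
    using that less_arctan_iff[of s "y / x"] by (auto simp: field_simps)
  have scaled: "lx * ly * (1 / (2 * lx * ly) * z) = z / 2" for z
    using sides_pos by simp
  note slice = nn_integral_radial_slice_abs[where c = "cos t" and s = "sin t"]
  consider (q1) "0 \<le> t" "t < pi/2" | (q2) "pi/2 \<le> t" "t < pi" | (q3) "pi \<le> t" "t < 3*pi/2"
    | (q4) "3*pi/2 \<le> t" "t < 2*pi" using t by force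
  then show ?thesis
  proof cases
    case q1
    then have cs: "0 \<le> cos t" "0 \<le> sin t" by (auto intro!: cos_ge_zero sin_ge_zero)
    have iff: "t < \<gamma>\<^sub>1 \<longleftrightarrow> a\<^sub>1 * sin t < b\<^sub>1 * cos t"
      using arctan_cases[of a\<^sub>1 t b\<^sub>1] q1 h_pos by (simp add: gamma1_def)
    have "azimuth_density lx ly ux uy t =
        1 / (2 * lx * ly) * (if t < \<gamma>\<^sub>1 then a\<^sub>1\<^sup>2 / (cos t)\<^sup>2 else b\<^sub>1\<^sup>2 / (sin t)\<^sup>2)"
      using q1 gamma_order by (simp add: azimuth_density_expand indicator_def)
    moreover have "?L = ennreal ((if a\<^sub>1 * sin t < b\<^sub>1 * cos t then a\<^sub>1\<^sup>2 / (cos t)\<^sup>2 else b\<^sub>1\<^sup>2 / (sin t)\<^sup>2) / 2)"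
      by (rule slice)
         (use cs nz h_pos nonpos[of _ "- cos t" a\<^sub>2] nonpos[of _ "- sin t" b\<^sub>2] in \<open>auto simp: in_rectangle_iff\<close>)
    ultimately show ?thesis by (simp only: iff scaled)
  next
    case q2
    then have cs: "0 \<le> - cos t" "0 \<le> sin t"
      using cos_ge_zero[of "t - pi"] by (auto intro!: sin_ge_zero)
    \<comment> \<open>Subtracting pi returns to the principal branch of the arctangent and flips the
      signs of sine and cosine.\<close>
    have iff: "t < \<gamma>\<^sub>2 \<longleftrightarrow> b\<^sub>1 * (- cos t) < a\<^sub>2 * sin t"
      using arctan_cases[of "h_xm lx ux" "t - pi" b\<^sub>1] q2 h_pos by (simp add: gamma2_def less_diff_eq[symmetric] diff_less_eq)
    have "azimuth_density lx ly ux uy t =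
        1 / (2 * lx * ly) * (if t < \<gamma>\<^sub>2 then b\<^sub>1\<^sup>2 / (sin t)\<^sup>2 else a\<^sub>2\<^sup>2 / (- cos t)\<^sup>2)"
      using q2 gamma_order by (simp add: azimuth_density_expand indicator_def)
    moreover have "?L = ennreal ((if b\<^sub>1 * (- cos t) < a\<^sub>2 * sin t then b\<^sub>1\<^sup>2 / (sin t)\<^sup>2 else a\<^sub>2\<^sup>2 / (- cos t)\<^sup>2) / 2)"
      by (rule slice)
         (use cs nz h_pos nonpos[of _ "cos t" a\<^sub>1] nonpos[of _ "- sin t" b\<^sub>2] in \<open>auto simp: in_rectangle_iff\<close>)
    ultimately show ?thesis by (simp only: iff scaled)
  next
    case q3
    then have cs: "0 \<le> - cos t" "0 \<le> - sin t"
      using cos_ge_zero[of "t - pi"] sin_ge_zero[of "t - pi"] by auto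
    have iff: "t < \<gamma>\<^sub>3 \<longleftrightarrow> a\<^sub>2 * (- sin t) < b\<^sub>2 * (- cos t)"
      using arctan_cases[of "h_xm lx ux" "t - pi" "h_ym ly uy"] q3 h_pos by (simp add: gamma3_def diff_less_eq)
    have "azimuth_density lx ly ux uy t =
        1 / (2 * lx * ly) * (if t < \<gamma>\<^sub>3 then a\<^sub>2\<^sup>2 / (- cos t)\<^sup>2 else b\<^sub>2\<^sup>2 / (- sin t)\<^sup>2)"
      using q3 gamma_order by (simp add: azimuth_density_expand indicator_def)
    moreover have "?L = ennreal ((if a\<^sub>2 * (- sin t) < b\<^sub>2 * (- cos t) then a\<^sub>2\<^sup>2 / (- cos t)\<^sup>2 else b\<^sub>2\<^sup>2 / (- sin t)\<^sup>2) / 2)"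
      by (rule slice)
         (use cs nz h_pos nonpos[of _ "cos t" a\<^sub>1] nonpos[of _ "sin t" b\<^sub>1] in \<open>auto simp: in_rectangle_iff\<close>)
    ultimately show ?thesis by (simp only: iff scaled)
  next
    case q4
    then have cs: "0 \<le> cos t" "0 \<le> - sin t"
      using cos_ge_zero[of "t - 2*pi"] sin_ge_zero[of "t - pi"] cos_periodic[of "t - 2*pi"] by auto
    have iff: "t < \<gamma>\<^sub>4 \<longleftrightarrow> b\<^sub>2 * cos t < a\<^sub>1 * (- sin t)"
      using arctan_cases[of a\<^sub>1 "t - 2*pi" "h_ym ly uy"] q4 h_pos
        sin_periodic[of "t - 2*pi"] cos_periodic[of "t - 2*pi"] by (auto simp: gamma4_def diff_less_eq)
    have "azimuth_density lx ly ux uy t =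
        1 / (2 * lx * ly) * (if t < \<gamma>\<^sub>4 then b\<^sub>2\<^sup>2 / (- sin t)\<^sup>2 else a\<^sub>1\<^sup>2 / (cos t)\<^sup>2)"
      using q4 gamma_order by (simp add: azimuth_density_expand indicator_def)
    moreover have "?L = ennreal ((if b\<^sub>2 * cos t < a\<^sub>1 * (- sin t) then b\<^sub>2\<^sup>2 / (- sin t)\<^sup>2 else a\<^sub>1\<^sup>2 / (cos t)\<^sup>2) / 2)"
      by (rule slice)
         (use cs nz h_pos nonpos[of _ "- cos t" a\<^sub>2] nonpos[of _ "sin t" b\<^sub>1] in \<open>auto simp: in_rectangle_iff\<close>)
    ultimately show ?thesis by (simp only: iff scaled)
  qed
qed

section \<open>From the uniform law to the law of the azimuth\<close>

lemma measure_rectangle: "measure lborel (rectangle lx ly) = lx * ly"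
proof -
  have "rectangle lx ly = cbox (- lx / 2, - ly / 2) (lx / 2, ly / 2)"
    by (simp add: rectangle_def cbox_Pair_eq)
  then show ?thesis using sides_pos by (simp add: content_Pair)
qed

text \<open>After moving the reference point to the origin, the azimuth is constant along each open
  ray, so \<open>indicator A t\<close> leaves the radial integral. What remains is the radial slice,
  whose factor \<open>lx * ly\<close> cancels against the uniform density.\<close>

lemma nn_integral_uniform_Arg2pi:
  assumes [measurable]: "A \<in> sets borel"
  shows "(\<integral>\<^sup>+v. ennreal (indicator (rectangle lx ly) v / (lx * ly)) *
      indicator A (Arg2pi (Complex (fst v - ux) (snd v - uy))) \<partial>lborel) =
    (\<integral>\<^sup>+t. ennreal (azimuth_density lx ly ux uy t) * indicator A t \<partial>lborel)" (is "integral\<^sup>N _ ?f = _")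
proof -
  have [measurable]: "rectangle lx ly \<in> sets borel"
    unfolding rectangle_def by (intro borel_closed closed_Times) auto
  have [measurable]: "?f \<in> borel_measurable borel" by measurable
  have "integral\<^sup>N lborel ?f = (\<integral>\<^sup>+v. ?f ((ux, uy) + v) \<partial>lborel)"
    by (rule nn_integral_translate) measurable
  also have "\<dots> = (\<integral>\<^sup>+t. indicator {0..<2*pi} t *
      (\<integral>\<^sup>+r. ennreal r * ?f ((ux, uy) + (r * cos t, r * sin t)) \<partial>lborel) \<partial>lborel)"
    by (rule nn_integral_polar) measurable
  also have "\<dots> = (\<integral>\<^sup>+t. ennreal (azimuth_density lx ly ux uy t) * indicator A t \<partial>lborel)"
  proof (rule nn_integral_cong)
    fix t :: real
    show "indicator {0..<2*pi} t * (\<integral>\<^sup>+r. ennreal r * ?f ((ux, uy) + (r * cos t, r * sin t)) \<partial>lborel) =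
        ennreal (azimuth_density lx ly ux uy t) * indicator A t"
    proof (cases "t \<in> {0..<2*pi}")
      case True
      have "ennreal r * ?f ((ux, uy) + (r * cos t, r * sin t)) = ennreal (1 / (lx * ly)) * indicator A t *
          (ennreal r * indicator (rectangle lx ly) (ux + r * cos t, uy + r * sin t))" for r
      \<comment> \<open>At \<open>r = 0\<close> the argument is 0 rather than \<open>t\<close>, and
        for negative \<open>r\<close> the ray is reversed; the weight \<open>ennreal r\<close>
        vanishes in both cases.\<close>
      proof (cases "0 < r")
        case r: True
        have "Arg2pi (Complex (r * cos t) (r * sin t)) = t"
          using True r by (intro Arg2pi_unique[of r]) (auto simp: exp_eq_polar complex_eq_iff)
        then show ?thesis by (auto simp: indicator_def mult_ac)
      qed (simp add: ennreal_neg)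
      then have "(\<integral>\<^sup>+r. ennreal r * ?f ((ux, uy) + (r * cos t, r * sin t)) \<partial>lborel) =
          ennreal (1 / (lx * ly)) * indicator A t * ennreal (lx * ly * azimuth_density lx ly ux uy t)"
        by (simp add: nn_integral_cmult nn_integral_radial_slice[OF True])
      also have "\<dots> = ennreal (azimuth_density lx ly ux uy t) * indicator A t"
        using sides_pos by (auto simp: indicator_def ennreal_mult'[symmetric])
      finally show ?thesis using True by simp
    qed (simp add: azimuth_density_outside)
  qed
  finally show ?thesis .
qed

end

theorem corollary5:
  fixes M :: "'a measure" and V :: "'a \<Rightarrow> real \<times> real" and R \<Theta> :: "'a \<Rightarrow> real"
    and lx ly ux uy :: real
  assumes "prob_space M"
    and "lx > 0" and "ly > 0"
    and "\<bar>ux\<bar> < lx / 2" and "\<bar>uy\<bar> < ly / 2"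
    and "distributed M lborel V
          (\<lambda>v. ennreal (indicator (rectangle lx ly) v / measure lborel (rectangle lx ly)))"
    and "\<Theta> \<in> borel_measurable M"
    and "\<And>\<omega>. \<omega> \<in> space M \<Longrightarrow> \<Theta> \<omega> \<in> {0 ..< 2 * pi}"
    and "\<And>\<omega>. \<omega> \<in> space M \<Longrightarrow> R \<omega> \<ge> 0"
    and "\<And>\<omega>. \<omega> \<in> space M \<Longrightarrow>
          V \<omega> - (ux, uy) = (R \<omega> * cos (\<Theta> \<omega>), R \<omega> * sin (\<Theta> \<omega>))"
  shows "distributed M lborel \<Theta> (\<lambda>\<theta>. ennreal (azimuth_density lx ly ux uy \<theta>))
    \<and> disjoint_family_on (chi_interval lx ly ux uy) {1..8}"
proof -
  interpret rectangle_point lx ly ux uy using assms by unfold_locales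
  let ?p = "\<lambda>v. ennreal (indicator (rectangle lx ly) v / (lx * ly))"
  let ?Z = "\<lambda>v. Arg2pi (Complex (fst v - ux) (snd v - uy))"
  have V: "distributed M lborel V ?p"
    using assms(6) by (simp only: measure_rectangle)
  have [measurable]: "V \<in> borel_measurable M" "\<Theta> \<in> borel_measurable M"
    using distributed_measurable[OF V] assms(7) by auto
  have [measurable]: "?Z \<in> borel_measurable borel" by measurable
  \<comment> \<open>At the reference point \<open>R\<close> is 0 and the angle is arbitrary. Since
    \<open>V\<close> has a Lebesgue density, this event is null; elsewhere \<open>R\<close> is
    positive and the angle in [0, 2 pi) is unique.\<close>
  have "AE v in distr M lborel V. v \<noteq> (ux, uy)"
    unfolding distributed_distr_eq_density[OF V]
    using AE_lborel_singleton[of "(ux, uy)"] distributed_borel_measurable[OF V]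
    by (subst AE_density) auto
  then have "AE \<omega> in M. V \<omega> \<noteq> (ux, uy)"
    by (subst (asm) AE_distr_iff) auto
  then have \<Theta>_eq: "AE \<omega> in M. \<Theta> \<omega> = ?Z (V \<omega>)"
  proof (rule AE_mp, intro AE_I2 impI)
    fix \<omega> assume \<omega>: "\<omega> \<in> space M" "V \<omega> \<noteq> (ux, uy)"
    have eq: "fst (V \<omega>) - ux = R \<omega> * cos (\<Theta> \<omega>)" "snd (V \<omega>) - uy = R \<omega> * sin (\<Theta> \<omega>)"
      using assms(10)[OF \<omega>(1)] by (simp_all add: prod_eq_iff)
    then have "R \<omega> \<noteq> 0" using \<omega>(2) by (auto simp: prod_eq_iff)
    then show "\<Theta> \<omega> = ?Z (V \<omega>)"
      using assms(8,9)[OF \<omega>(1)] unfolding eq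
      by (intro Arg2pi_unique[of "R \<omega>", symmetric]) (auto simp: exp_eq_polar complex_eq_iff)
  qed
  have "distr M lborel \<Theta> = density lborel (\<lambda>t. ennreal (azimuth_density lx ly ux uy t))"
  proof (rule measure_eqI)
    fix A assume "A \<in> sets (distr M lborel \<Theta>)"
    then have [measurable]: "A \<in> sets borel" by simp
    \<comment> \<open>Written as the expectation of an indicator, the probability allows
      \<open>\<Theta>\<close> to be replaced by an almost surely equal function of \<open>V\<close>,
      after which the density of \<open>V\<close> applies.\<close>
    have "emeasure (distr M lborel \<Theta>) A = (\<integral>\<^sup>+\<omega>. indicator A (\<Theta> \<omega>) \<partial>M)"
      by (subst nn_integral_distr[symmetric, where M'=lborel]) auto
    also have "\<dots> = (\<integral>\<^sup>+\<omega>. indicator A (?Z (V \<omega>)) \<partial>M)"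
      by (rule nn_integral_cong_AE) (use \<Theta>_eq in eventually_elim, simp)
    also have "\<dots> = (\<integral>\<^sup>+v. ?p v * indicator A (?Z v) \<partial>lborel)"
      by (rule distributed_nn_integral[OF V, symmetric]) measurable
    also have "\<dots> = (\<integral>\<^sup>+t. ennreal (azimuth_density lx ly ux uy t) * indicator A t \<partial>lborel)"
      by (rule nn_integral_uniform_Arg2pi) measurable
    finally show "emeasure (distr M lborel \<Theta>) A =
        emeasure (density lborel (\<lambda>t. ennreal (azimuth_density lx ly ux uy t))) A"
      by (simp add: emeasure_density)
  qed simp
  then show ?thesis
    using disjoint_chi_interval by (simp add: distributed_def)
qed

end
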